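(* Let $n\ge1$, $r\ge1$ be integers and let $\lambda(x)=\exp\left(\frac{2\pi\sqrt{-1}\,ax}{n}\right)$ for some $a\in\mathbb{Z}$, with $d=\gcd(a,n)$ (so $\lambda$ has order $n/d$). Then $$G(\mathrm{SL}_r(\mathbb{Z}_n),\lambda)=n^{\frac{r(r-1)}{2}}d^{\frac{r(r+1)}{2}-1}\prod_{\substack{p\mid n\\ p\nmid n/d}}\prod_{i=2}^r(1-p^{-i})\cdot K_r(\mathbb{Z}_{n/d},\lambda),$$ where the outer product is over primes $p$.
   Context: $\mathbb{Z}_m=\mathbb{Z}/m\mathbb{Z}$; $\mathrm{SL}_r(\mathbb{Z}_m)$ is the group of $r\times r$ matrices over $\mathbb{Z}_m$ with determinant $1$. $G(\mathrm{SL}_r(\mathbb{Z}_n),\lambda)=\sum_{X\in\mathrm{SL}_r(\mathbb{Z}_n)}\lambda(\mathrm{tr}\,X)$. For an additive character $\mu$ of $\mathbb{Z}_m$, the hyper-Kloosterman sum is $K_r(\mathbb{Z}_m,\mu)=\sum_{x_1,\dots,x_r\in\mathbb{Z}_m,\ x_1\cdots x_r=1}\mu(x_1+\cdots+x_r)$. Here $\lambda$ is regarded as a character of $\mathbb{Z}_{n/d}$ via $\lambda(x\bmod n/d)=\exp\left(\frac{2\pi\sqrt{-1}(a/d)x}{n/d}\right)$, which is well defined. *)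

theory Defs
  imports
    Complex_Main
    "HOL-Library.FuncSet"
    "HOL-Number_Theory.Cong"
    "Jordan_Normal_Form.Determinant"
begin

text \<open>
  The residue ring modulo \<open>m \<ge> 1\<close> is represented by its canonical residues \<open>{0..<int m}\<close>,
  with sums and products of residues formed in the integers and reduced modulo \<open>m\<close>.
  Equations are congruences rather than equations between representatives, so that the trivial
  ring (\<open>m = 1\<close>), where \<open>0\<close> and \<open>1\<close> coincide, is covered.
\<close>

definition zmod :: "nat \<Rightarrow> int set" where
  "zmod m = {0..<int m}"

definition SL :: "nat \<Rightarrow> nat \<Rightarrow> int mat set" where
  "SL r m = {X \<in> carrier_mat r r. elements_mat X \<subseteq> zmod m \<and> [det X = 1] (mod int m)}"

definition mat_trace :: "'a::comm_monoid_add mat \<Rightarrow> 'a" where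
  "mat_trace X = (\<Sum>i<dim_row X. X $$ (i, i))"

definition add_char :: "nat \<Rightarrow> int \<Rightarrow> int \<Rightarrow> complex" where
  "add_char m a x = exp (2 * of_real pi * \<i> * of_int a * of_int x / of_nat m)"

text \<open>
  In the next two definitions \<open>\<mu>\<close> is a function on the residue ring, so it is evaluated at
  canonical residues only.
\<close>

definition SL_gauss_sum :: "nat \<Rightarrow> nat \<Rightarrow> (int \<Rightarrow> complex) \<Rightarrow> complex" where
  "SL_gauss_sum r m \<mu> = (\<Sum>X\<in>SL r m. \<mu> (mat_trace X mod int m))"

definition hyper_kloosterman :: "nat \<Rightarrow> nat \<Rightarrow> (int \<Rightarrow> complex) \<Rightarrow> complex" where
  "hyper_kloosterman r m \<mu> =
     (\<Sum>x \<in> {x \<in> {1..r} \<rightarrow>\<^sub>E zmod m. [(\<Prod>i=1..r. x i) = 1] (mod int m)}.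
        \<mu> ((\<Sum>i=1..r. x i) mod int m))"

lemma add_char_eq_1_iff:
  assumes "m \<ge> 1"
  shows "add_char m a x = 1 \<longleftrightarrow> int m dvd a * x"
proof -
  have m: "real m \<noteq> 0" using assms by simp
  have e: "2 * of_real pi * \<i> * of_int a * of_int x / of_nat m
           = \<i> * of_real (2 * pi * (of_int (a * x) / real m))"
    by simp
  have "add_char m a x = 1 \<longleftrightarrow> cos (2 * pi * (of_int (a * x) / real m)) = 1"
    unfolding add_char_def e cis_conv_exp[symmetric]
    by (auto simp: complex_eq_iff cos_one_sin_zero)
  also have "\<dots> \<longleftrightarrow> (\<exists>k::int. 2 * pi * (of_int (a * x) / real m) = of_int k * 2 * pi)"
    by (rule cos_one_2pi_int)
  also have "\<dots> \<longleftrightarrow> (\<exists>k::int. real_of_int (a * x) = of_int (int m * k))"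
    using m by (simp add: field_simps)
  also have "\<dots> \<longleftrightarrow> int m dvd a * x"
    unfolding of_int_eq_iff dvd_def by simp
  finally show ?thesis .
qed

lemma add_char_add: "add_char m a (x + y) = add_char m a x * add_char m a y"
  by (simp add: add_char_def algebra_simps add_divide_distrib flip: exp_add)

lemma add_char_mod:
  assumes "m \<ge> 1"
  shows "add_char m a (x mod int m) = add_char m a x"
proof -
  have "add_char m a x = add_char m a (x mod int m + int m * (x div int m))"
    by simp
  also have "\<dots> = add_char m a (x mod int m)"
    using add_char_eq_1_iff[OF assms, of a "int m * (x div int m)"]
    by (simp only: add_char_add) simp
  finally show ?thesis by simp
qed

text \<open>
  The character of the residue ring modulo \<open>n div d\<close> given by \<open>a div d\<close> is the one through which
  the character modulo \<open>n\<close> given by \<open>a\<close> factors.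
\<close>

lemma add_char_reduce:
  assumes "n \<ge> 1" and "d dvd n" and "int d dvd a"
  shows "add_char (n div d) (a div int d) (x mod int (n div d)) = add_char n a x"
proof -
  from assms obtain m b where mb: "n = d * m" "a = int d * b" by (auto elim!: dvdE)
  with assms have pos: "d \<ge> 1" "m \<ge> 1" by (auto simp: Suc_le_eq)
  have "add_char m b x = add_char n a x"
    using pos by (simp add: mb add_char_def mult.assoc mult.left_commute)
  with pos show ?thesis by (simp add: mb add_char_mod)
qed

end

theory Submission
  imports Defs
begin

text \<open>
  Write \<open>n = m d\<close>. The character factors through residues modulo \<open>m\<close>, where it is primitive, so the
  sum over \<open>SL\<close> modulo \<open>n\<close> is the sum over \<open>SL\<close> modulo \<open>m\<close> times the common size of the fibres of
  reduction. Enlarging the modulus by one prime \<open>p\<close> at a time, the fibres are counted by induction on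
  the size of the matrix: there are \<open>p^r\<close> lifts of the first column, minus the one vanishing modulo \<open>p\<close>
  if \<open>p\<close> does not divide the old modulus, and left multiplication by a matrix with that first column
  reduces the rest to a block of size \<open>r - 1\<close>. For a primitive character, averaging over
  translations by unitriangular matrices leaves only upper triangular matrices, whose diagonals
  give the Kloosterman sum.
\<close>

subsection \<open>Integer matrices modulo n\<close>

text \<open>Residue matrices remain integer matrices, compared entrywise modulo \<open>n\<close>.
  Identities for determinants and adjugates over the integers then apply unchanged, and passing to a
  divisor of the modulus needs no map between rings.\<close>

definition mat_cong :: "nat \<Rightarrow> int \<Rightarrow> int mat \<Rightarrow> int mat \<Rightarrow> bool" where
  "mat_cong r n A B \<longleftrightarrow> (\<forall>i<r. \<forall>j<r. [A $$ (i,j) = B $$ (i,j)] (mod n))"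

definition mat_mod :: "nat \<Rightarrow> int mat \<Rightarrow> int mat" where
  "mat_mod n A = map_mat (\<lambda>x. x mod int n) A"

definition residue_mats :: "nat \<Rightarrow> nat \<Rightarrow> int mat set" where
  "residue_mats r n = {X \<in> carrier_mat r r. elements_mat X \<subseteq> zmod n}"

lemma mem_residue_mats:
  "X \<in> residue_mats r n \<longleftrightarrow> X \<in> carrier_mat r r \<and> (\<forall>i<r. \<forall>j<r. X $$ (i,j) \<in> zmod n)"
  unfolding residue_mats_def by (fastforce dest: elements_matD intro: elements_matI)

lemma SL_eq: "SL r n = {X \<in> residue_mats r n. [det X = 1] (mod int n)}"
  by (auto simp: SL_def residue_mats_def)

lemma mat_cong_refl [simp]: "mat_cong r n A A"
  by (simp add: mat_cong_def)

lemma mat_cong_sym: "mat_cong r n A B \<Longrightarrow> mat_cong r n B A"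
  by (auto simp: mat_cong_def cong_sym)

lemma mat_cong_trans [trans]: "mat_cong r n A B \<Longrightarrow> mat_cong r n B C \<Longrightarrow> mat_cong r n A C"
  unfolding mat_cong_def by (blast intro: cong_trans)

lemma mat_cong_dvd: "mat_cong r n A B \<Longrightarrow> m dvd n \<Longrightarrow> mat_cong r m A B"
  by (auto simp: mat_cong_def intro: cong_dvd_modulus)

lemma index_mat_mult:
  assumes "A \<in> carrier_mat r r" "B \<in> carrier_mat r r" "i < r" "j < r"
  shows "(A * B) $$ (i,j) = (\<Sum>k<r. A $$ (i,k) * B $$ (k,j))"
  using assms by (auto simp: scalar_prod_def atLeast0LessThan intro!: sum.cong)

lemma mat_cong_mult:
  assumes "A \<in> carrier_mat r r" "B \<in> carrier_mat r r"
    and "A' \<in> carrier_mat r r" "B' \<in> carrier_mat r r"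
    and "mat_cong r n A A'" "mat_cong r n B B'"
  shows "mat_cong r n (A * B) (A' * B')"
  unfolding mat_cong_def
proof (intro allI impI)
  fix i j assume ij: "i < r" "j < r"
  show "[(A * B) $$ (i,j) = (A' * B') $$ (i,j)] (mod n)"
    unfolding index_mat_mult[OF assms(1,2) ij] index_mat_mult[OF assms(3,4) ij]
    using assms(5,6) ij by (intro cong_sum cong_mult) (auto simp: mat_cong_def)
qed

text \<open>The Leibniz formula makes the determinant a polynomial in the entries with integer
  coefficients.\<close>

lemma det_cong:
  assumes "A \<in> carrier_mat r r" "B \<in> carrier_mat r r" "mat_cong r n A B"
  shows "[det A = det B] (mod n)"
  unfolding det_def'[OF assms(1)] det_def'[OF assms(2)]
proof (intro cong_sum cong_mult cong_refl cong_prod)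
  fix p i assume "p \<in> {p. p permutes {0..<r}}" "i \<in> {0..<r}"
  then have "i < r" "p i < r" by (auto dest: permutes_in_image[of p _ i])
  then show "[A $$ (i, p i) = B $$ (i, p i)] (mod n)"
    using assms(3) by (auto simp: mat_cong_def)
qed

lemma mat_mod_carrier [simp]: "mat_mod n A \<in> carrier_mat r c \<longleftrightarrow> A \<in> carrier_mat r c"
  by (auto simp: mat_mod_def)

lemma index_mat_mod [simp]:
  "A \<in> carrier_mat r r \<Longrightarrow> i < r \<Longrightarrow> j < r \<Longrightarrow> mat_mod n A $$ (i,j) = A $$ (i,j) mod int n"
  by (auto simp: mat_mod_def)

lemma mat_mod_residue:
  assumes "n \<ge> 1" "A \<in> carrier_mat r r"
  shows "mat_mod n A \<in> residue_mats r n"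
  using assms by (auto simp: mem_residue_mats zmod_def)

lemma mat_cong_mat_mod: "A \<in> carrier_mat r r \<Longrightarrow> mat_cong r (int n) (mat_mod n A) A"
  by (auto simp: mat_cong_def cong_def)

lemma residue_mats_eqI:
  assumes "A \<in> residue_mats r n" "B \<in> residue_mats r n" "mat_cong r (int n) A B"
  shows "A = B"
proof (rule eq_matI)
  fix i j assume "i < dim_row B" "j < dim_col B"
  then have ij: "i < r" "j < r" using assms by (auto simp: mem_residue_mats)
  then show "A $$ (i,j) = B $$ (i,j)" using assms
    by (auto simp: mem_residue_mats mat_cong_def zmod_def cong_def)
qed (use assms in \<open>auto simp: mem_residue_mats\<close>)

lemma finite_residue_mats [simp]: "finite (residue_mats r n)"
proof (rule finite_subset)
  let ?S = "PiE ({..<r} \<times> {..<r}) (\<lambda>_. zmod n)"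
  show "residue_mats r n \<subseteq> (\<lambda>f. mat r r f) ` ?S"
  proof
    fix X assume X: "X \<in> residue_mats r n"
    have "X = mat r r (restrict (\<lambda>ij. X $$ ij) ({..<r} \<times> {..<r}))"
      using X by (intro eq_matI) (auto simp: mem_residue_mats)
    moreover have "restrict (\<lambda>ij. X $$ ij) ({..<r} \<times> {..<r}) \<in> ?S"
      using X by (auto simp: mem_residue_mats)
    ultimately show "X \<in> (\<lambda>f. mat r r f) ` ?S" by blast
  qed
  show "finite ((\<lambda>f. mat r r f) ` ?S)" by (intro finite_imageI finite_PiE) (auto simp: zmod_def)
qed

lemma finite_SL [simp]: "finite (SL r n)"
  by (simp add: SL_eq)

section \<open>Left multiplication by matrices invertible modulo n\<close>

lemma mat_mod_mult_cancel:
  assumes "n \<ge> 1" and P: "P \<in> carrier_mat r r" "Q \<in> carrier_mat r r"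
    and inv: "mat_cong r (int n) (Q * P) (1\<^sub>m r)" and X: "X \<in> residue_mats r n"
  shows "mat_mod n (Q * mat_mod n (P * X)) = X"
proof (rule residue_mats_eqI)
  have c: "X \<in> carrier_mat r r" using X by (simp add: mem_residue_mats)
  show "mat_mod n (Q * mat_mod n (P * X)) \<in> residue_mats r n"
    using assms c by (intro mat_mod_residue) auto
  have "mat_cong r (int n) (mat_mod n (Q * mat_mod n (P * X))) (Q * mat_mod n (P * X))"
    using P c by (intro mat_cong_mat_mod) auto
  also have "mat_cong r (int n) \<dots> (Q * (P * X))"
    using P c by (intro mat_cong_mult mat_cong_mat_mod) auto
  also have "Q * (P * X) = (Q * P) * X" using P c by simp
  also have "mat_cong r (int n) \<dots> (1\<^sub>m r * X)"
    using P c inv by (intro mat_cong_mult) auto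
  finally show "mat_cong r (int n) (mat_mod n (Q * mat_mod n (P * X))) X"
    using c by simp
qed (use X in auto)

text \<open>The sets \<open>S\<close> and \<open>T\<close> are left open because there are two uses:
  bringing the first column of the matrices in a fibre to a standard form, and translating
  \<open>SL\<close> by a unitriangular matrix.\<close>

lemma bij_betw_mat_mod_mult:
  assumes "n \<ge> 1" "P \<in> carrier_mat r r" "Q \<in> carrier_mat r r"
    and "mat_cong r (int n) (Q * P) (1\<^sub>m r)" "mat_cong r (int n) (P * Q) (1\<^sub>m r)"
    and "S \<subseteq> residue_mats r n" "T \<subseteq> residue_mats r n"
    and "\<And>X. X \<in> S \<Longrightarrow> mat_mod n (P * X) \<in> T" "\<And>X. X \<in> T \<Longrightarrow> mat_mod n (Q * X) \<in> S"
  shows "bij_betw (\<lambda>X. mat_mod n (P * X)) S T"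
  using assms by (intro bij_betw_byWitness[where f' = "\<lambda>X. mat_mod n (Q * X)"])
    (auto simp: mat_mod_mult_cancel subset_iff)

text \<open>The inverse is the adjugate scaled by an inverse \<open>x\<close> of the determinant
  modulo \<open>n\<close>; both products are then \<open>x * det P\<close> times the
  identity.\<close>

lemma mat_inverse_mod:
  assumes P: "P \<in> carrier_mat r r" and "coprime (det P) (int n)"
  obtains Q where "Q \<in> carrier_mat r r" "mat_cong r (int n) (Q * P) (1\<^sub>m r)"
    "mat_cong r (int n) (P * Q) (1\<^sub>m r)"
proof -
  obtain x where x: "[det P * x = 1] (mod int n)"
    using assms(2) by (auto simp: coprime_iff_invertible_int)
  have Q: "x \<cdot>\<^sub>m adj_mat P \<in> carrier_mat r r" using adj_mat(1)[OF P] by simp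
  have e: "(x \<cdot>\<^sub>m adj_mat P) * P = (x * det P) \<cdot>\<^sub>m 1\<^sub>m r" "P * (x \<cdot>\<^sub>m adj_mat P) = (x * det P) \<cdot>\<^sub>m 1\<^sub>m r"
    using adj_mat[OF P] P by (auto simp: mult_smult_distrib mult_smult_assoc_mat intro!: eq_matI)
  show thesis
    by (rule that[OF Q]; unfold e) (use x in \<open>auto simp: mat_cong_def mult.commute\<close>)
qed

subsection \<open>Unimodular columns and lifts of residues\<close>

text \<open>Euclid's algorithm on the column: while two entries are nonzero, a row operation lowers
  the sum of absolute values, and the matrix found for the smaller column is carried back by the
  inverse operation. At the end at most one entry is nonzero; it is coprime to \<open>n\<close>, and
  a scalar matrix with two rows possibly swapped does the job. Its determinant is only a unit modulo
  \<open>n\<close>, not 1.\<close>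

lemma mat_with_unimodular_column:
  fixes v :: "nat \<Rightarrow> int"
  assumes "r \<ge> 1" and "\<And>q. q dvd int n \<Longrightarrow> \<forall>i<r. q dvd v i \<Longrightarrow> is_unit q"
  shows "\<exists>P \<in> carrier_mat r r. coprime (det P) (int n) \<and> (\<forall>i<r. P $$ (i,0) = v i)"
  using assms(2)
proof (induction "\<Sum>i<r. nat \<bar>v i\<bar>" arbitrary: v rule: less_induct)
  case less
  show ?case
  proof (cases "\<exists>i<r. \<exists>j<r. i \<noteq> j \<and> v i \<noteq> 0 \<and> v j \<noteq> 0")
    case True
    then obtain i j where ij: "i < r" "j < r" "i \<noteq> j" "v i \<noteq> 0" "v j \<noteq> 0" "\<bar>v j\<bar> \<le> \<bar>v i\<bar>"
      by (metis linorder_linear)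
    \<comment> \<open>The sign makes \<open>s * v j\<close> opposite to \<open>v i\<close>. As
      \<open>v j\<close> is nonzero and not the larger in absolute value, adding it brings entry
      \<open>i\<close> strictly closer to 0.\<close>
    define s where "s = - sgn (v i) * sgn (v j)"
    define w where "w = v(i := v i + s * v j)"
    have "\<bar>v i + s * v j\<bar> < \<bar>v i\<bar>"
      using ij by (auto simp: s_def sgn_if)
    then have "(\<Sum>k<r. nat \<bar>w k\<bar>) < (\<Sum>k<r. nat \<bar>v k\<bar>)"
      using ij by (intro sum_strict_mono_ex1) (auto simp: w_def)
    moreover have "is_unit q" if q: "q dvd int n" "\<forall>k<r. q dvd w k" for q
    proof (rule less.prems[OF q(1)], intro allI impI)
      fix k assume k: "k < r"
      have "q dvd v j" using q(2) ij by (auto simp: w_def)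
      moreover have "q dvd v i + s * v j" using q(2) ij by (auto simp: w_def)
      ultimately have "q dvd v i" by (metis dvd_add_left_iff dvd_mult)
      then show "q dvd v k" using q(2) k by (cases "k = i") (auto simp: w_def)
    qed
    ultimately obtain P where P: "P \<in> carrier_mat r r" "coprime (det P) (int n)"
      "\<forall>k<r. P $$ (k,0) = w k"
      using less.hyps by metis
    \<comment> \<open>Subtracting \<open>s\<close> times row \<open>j\<close> from row
      \<open>i\<close> undoes the change from \<open>v\<close> to \<open>w\<close>, since entry
      \<open>j\<close> is the same in both.\<close>
    have "addrow (- s) i j P $$ (k,0) = v k" if "k < r" for k
      using P ij that by (auto simp: w_def)
    moreover have "det (addrow (- s) i j P) = det P"
      using ij P by (intro det_addrow) auto
    ultimately show ?thesis using P by (intro bexI[of _ "addrow (- s) i j P"]) auto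
  next
    case False
    \<comment> \<open>\<open>k\<close> is the position of the only entry that can be nonzero; if the
      whole column is zero, position 0 serves.\<close>
    obtain k where k: "k < r" "\<And>i. i < r \<Longrightarrow> i \<noteq> k \<Longrightarrow> v i = 0"
    proof (cases "\<forall>i<r. v i = 0")
      case True
      then show ?thesis using that[of 0] \<open>r \<ge> 1\<close> by auto
    next
      case nz: False
      then obtain k where "k < r" "v k \<noteq> 0" by blast
      then show ?thesis using that[of k] False by blast
    qed
    have cop: "coprime (v k) (int n)"
    proof (rule coprimeI)
      fix q assume "q dvd v k" "q dvd int n"
      then show "is_unit q" using k by (intro less.prems) (metis dvd_0_right)+
    qed
    let ?D = "v k \<cdot>\<^sub>m 1\<^sub>m r"
    have D: "coprime (det ?D) (int n)" using cop by simp
    show ?thesis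
    proof (cases "k = 0")
      case True
      then show ?thesis using D k \<open>r \<ge> 1\<close> by (intro bexI[of _ ?D]) auto
    next
      case nz: False
      \<comment> \<open>The swap moves the nonzero entry of the first column from row 0 to row
        \<open>k\<close> and changes the determinant only by a sign.\<close>
      have "det (swaprows 0 k ?D) = - det ?D"
        using k nz by (intro det_swaprows) auto
      then show ?thesis using D k nz \<open>r \<ge> 1\<close>
        by (intro bexI[of _ "swaprows 0 k ?D"]) auto
    qed
  qed
qed

lemma dvd_det_if_dvd_column:
  fixes A :: "'a :: comm_ring_1 mat"
  assumes "A \<in> carrier_mat r r" "j < r" "\<And>i. i < r \<Longrightarrow> q dvd A $$ (i,j)"
  shows "q dvd det A"
  unfolding laplace_expansion_column[OF assms(1,2)] using assms(3) by (intro dvd_sum) auto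

text \<open>The first standard basis vector. As a column of a residue matrix it appears as
  \<open>unit_col i mod int n\<close>, because 1 is not a canonical residue when
  \<open>n = 1\<close>.\<close>

definition unit_col :: "nat \<Rightarrow> int" where
  "unit_col i = (if i = 0 then 1 else 0)"

text \<open>In the Laplace expansion along the first column only the corner term survives modulo
  \<open>n\<close>.\<close>

lemma det_cong_mat_delete:
  fixes X :: "int mat"
  assumes X: "X \<in> carrier_mat (Suc r) (Suc r)"
    and c: "\<And>i. i < Suc r \<Longrightarrow> [X $$ (i,0) = unit_col i] (mod n)"
  shows "[det X = det (mat_delete X 0 0)] (mod n)"
proof -
  have "det X = (\<Sum>i<Suc r. X $$ (i,0) * cofactor X i 0)"
    using X by (intro laplace_expansion_column) auto
  also have "[\<dots> = (\<Sum>i<Suc r. unit_col i * cofactor X i 0)] (mod n)"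
    using c by (intro cong_sum cong_mult) auto
  also have "(\<Sum>i<Suc r. unit_col i * cofactor X i 0) = det (mat_delete X 0 0)"
    by (subst sum.lessThan_Suc_shift) (simp add: unit_col_def cofactor_def)
  finally show ?thesis .
qed

lemma index_mat_delete_0 [simp]:
  "X \<in> carrier_mat (Suc r) (Suc r) \<Longrightarrow> i < r \<Longrightarrow> j < r \<Longrightarrow>
    mat_delete X 0 0 $$ (i,j) = X $$ (Suc i, Suc j)"
  by (auto simp: mat_delete_def)

text \<open>
  The determinant is an arbitrary \<open>c\<close> because the matrix completing a column in the induction step
  only has determinant a unit.
\<close>

definition cong_fibre :: "nat \<Rightarrow> nat \<Rightarrow> nat \<Rightarrow> int \<Rightarrow> int mat \<Rightarrow> int mat set" where
  "cong_fibre r n m c Y =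
     {X \<in> residue_mats r n. [det X = c] (mod int n) \<and> mat_cong r (int m) X Y}"

lemma finite_cong_fibre [simp]: "finite (cong_fibre r n m c Y)"
  by (simp add: cong_fibre_def)

definition lifts :: "nat \<Rightarrow> nat \<Rightarrow> int \<Rightarrow> int set" where
  "lifts n m y = {x \<in> zmod n. [x = y] (mod int m)}"

text \<open>Division with remainder by \<open>m\<close>: the lifts are
  \<open>y mod int m + int m * t\<close>, with the quotient \<open>t\<close> running through
  \<open>p\<close> values.\<close>

lemma card_lifts:
  assumes "m \<ge> 1"
  shows "card (lifts (m * p) m y) = p"
proof -
  have "bij_betw (\<lambda>t. y mod int m + int m * t) {0..<int p} (lifts (m * p) m y)"
  proof (rule bij_betw_byWitness[where f' = "\<lambda>x. x div int m"])
    show "\<forall>t\<in>{0..<int p}. (y mod int m + int m * t) div int m = t"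
      using assms by simp
    show "\<forall>x\<in>lifts (m * p) m y. y mod int m + int m * (x div int m) = x"
      by (auto simp: lifts_def cong_def) (metis mod_mult_div_eq)
    show "(\<lambda>t. y mod int m + int m * t) ` {0..<int p} \<subseteq> lifts (m * p) m y"
    proof (rule image_subsetI)
      fix t assume t: "t \<in> {0..<int p}"
      have "y mod int m < int m" using assms by simp
      moreover have "int m * t \<le> int m * (int p - 1)" using t assms by (intro mult_left_mono) auto
      ultimately have "y mod int m + int m * t < int m * int p" by (simp add: algebra_simps)
      then show "y mod int m + int m * t \<in> lifts (m * p) m y"
        using t assms by (auto simp: lifts_def zmod_def cong_def)
    qed
    show "(\<lambda>x. x div int m) ` lifts (m * p) m y \<subseteq> {0..<int p}"
    proof (rule image_subsetI)
      fix x assume x: "x \<in> lifts (m * p) m y"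
      have "int m * (x div int m) \<le> x"
        using mult_div_mod_eq[of "int m" x] pos_mod_sign[of "int m" x] assms by linarith
      also have "x < int m * int p" using x by (auto simp: lifts_def zmod_def)
      finally have "x div int m < int p" by (simp add: mult_less_cancel_left)
      then show "x div int m \<in> {0..<int p}"
        using x assms by (auto simp: lifts_def zmod_def pos_imp_zdiv_nonneg_iff)
    qed
  qed
  then show ?thesis using bij_betw_same_card by fastforce
qed

lemma finite_lifts [simp]: "finite (lifts n m y)"
  unfolding lifts_def by (rule finite_subset[of _ "{0..<int n}"]) (auto simp: zmod_def)

text \<open>By the Chinese remainder theorem, being \<open>y\<close> modulo \<open>m\<close> and 0
  modulo \<open>p\<close> singles out one residue modulo \<open>m * p\<close>.\<close>

lemma card_lifts_dvd:
  assumes "m \<ge> 1" "p \<ge> 1" "coprime m p"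
  shows "card {x \<in> lifts (m * p) m y. int p dvd x} = 1"
proof -
  have cop: "coprime (int m) (int p)" using assms by simp
  obtain x where x: "[x = y] (mod int m)" "[x = 0] (mod int p)"
    using binary_chinese_remainder_int[OF cop] by blast
  have "{x \<in> lifts (m * p) m y. int p dvd x} = {x mod int (m * p)}"
  proof (intro equalityI subsetI)
    fix z assume "z \<in> {x \<in> lifts (m * p) m y. int p dvd x}"
    then have z: "[z = y] (mod int m)" "[z = 0] (mod int p)" "z \<in> zmod (m * p)"
      by (auto simp: lifts_def cong_0_iff)
    have "[z = x] (mod (int m * int p))"
      using x z cop by (intro coprime_cong_mult) (auto intro: cong_trans cong_sym)
    then show "z \<in> {x mod int (m * p)}" using z(3) by (auto simp: cong_def zmod_def)
  next
    fix z assume z: "z \<in> {x mod int (m * p)}"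
    have "[z = x] (mod int m * int p)" using z by (auto simp: cong_def)
    then have "[z = x] (mod int m)" "[z = x] (mod int p)"
      by (auto intro: cong_dvd_modulus)
    then have "[z = y] (mod int m)" "[z = 0] (mod int p)" using x by (auto intro: cong_trans)
    moreover have "z \<in> zmod (m * p)" using z assms by (auto simp: zmod_def simp del: of_nat_mult)
    ultimately show "z \<in> {x \<in> lifts (m * p) m y. int p dvd x}"
      by (auto simp: lifts_def cong_0_iff)
  qed
  then show ?thesis by simp
qed

subsection \<open>Fibres of reduction\<close>

text \<open>Once the first column is the standard one, the determinant is that of the lower right
  block. The other \<open>r\<close> entries of the top row are therefore free, with \<open>p\<close>
  lifts each, while the block runs through a fibre of size \<open>r\<close>.\<close>

lemma card_cong_fibre_unit_col:
  fixes p m r :: nat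
  defines "n \<equiv> m * p"
  assumes "m \<ge> 1" "p \<ge> 1" and Z: "Z \<in> carrier_mat (Suc r) (Suc r)"
    and Z0: "\<And>i. i < Suc r \<Longrightarrow> [Z $$ (i,0) = unit_col i] (mod int m)"
  shows "card {X \<in> cong_fibre (Suc r) n m c Z. \<forall>i<Suc r. X $$ (i,0) = unit_col i mod int n} =
    p ^ r * card (cong_fibre r n m c (mat_delete Z 0 0))"
proof -
  let ?S = "{X \<in> cong_fibre (Suc r) n m c Z. \<forall>i<Suc r. X $$ (i,0) = unit_col i mod int n}"
  let ?W = "PiE {..<r} (\<lambda>j. lifts n m (Z $$ (0, Suc j)))"
  let ?F = "cong_fibre r n m c (mat_delete Z 0 0)"
  \<comment> \<open>Inverse to splitting a matrix into the rest \<open>w\<close> of its top row and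
    its lower right block \<open>X\<close>; both are indexed from 0, hence the shifts by 1.\<close>
  define glue where "glue = (\<lambda>(w :: nat \<Rightarrow> int, X). mat (Suc r) (Suc r) (\<lambda>(i,j).
    if j = 0 then unit_col i mod int n else if i = 0 then w (j - 1) else X $$ (i - 1, j - 1)))"
  have n: "n \<ge> 1" "m dvd n" using assms by auto
  have zm: "unit_col i mod int n \<in> zmod n" for i using n by (auto simp: zmod_def)
  have det_eq: "[det X = det (mat_delete X 0 0)] (mod int n)"
    if "X \<in> carrier_mat (Suc r) (Suc r)" "\<forall>i<Suc r. X $$ (i,0) = unit_col i mod int n" for X
    using that by (intro det_cong_mat_delete) (auto simp: cong_def)
  have carr: "glue (w, X) \<in> carrier_mat (Suc r) (Suc r)" for w X by (auto simp: glue_def)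
  have md: "mat_delete (glue (w, X)) 0 0 = X" if X: "X \<in> carrier_mat r r" for w X
  proof (rule eq_matI)
    fix i j assume "i < dim_row X" "j < dim_col X"
    then have "i < r" "j < r" using X by auto
    then show "mat_delete (glue (w, X)) 0 0 $$ (i,j) = X $$ (i,j)"
      unfolding index_mat_delete_0[OF carr \<open>i < r\<close> \<open>j < r\<close>] by (simp add: glue_def)
  qed (use X in \<open>auto simp: glue_def\<close>)
  have "bij_betw glue (?W \<times> ?F) ?S"
  proof (rule bij_betw_byWitness[where
        f' = "\<lambda>X. (restrict (\<lambda>j. X $$ (0, Suc j)) {..<r}, mat_delete X 0 0)"])
    show "\<forall>a\<in>?W \<times> ?F. (restrict (\<lambda>j. glue a $$ (0, Suc j)) {..<r}, mat_delete (glue a) 0 0) = a"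
    proof
      fix a assume "a \<in> ?W \<times> ?F"
      then obtain w X where a: "a = (w, X)" and w: "w \<in> ?W" and X: "X \<in> ?F" by auto
      have "restrict (\<lambda>j. glue (w, X) $$ (0, Suc j)) {..<r} = w"
        using w by (auto simp: glue_def PiE_iff extensional_def fun_eq_iff)
      moreover have "mat_delete (glue (w, X)) 0 0 = X"
        using X by (intro md) (simp add: cong_fibre_def mem_residue_mats)
      ultimately show "(restrict (\<lambda>j. glue a $$ (0, Suc j)) {..<r}, mat_delete (glue a) 0 0) = a"
        by (simp add: a)
    qed
    show "\<forall>X\<in>?S. glue (restrict (\<lambda>j. X $$ (0, Suc j)) {..<r}, mat_delete X 0 0) = X"
    proof
      fix X assume "X \<in> ?S"
      then have X: "X \<in> cong_fibre (Suc r) n m c Z"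
        "\<forall>i<Suc r. X $$ (i,0) = unit_col i mod int n"
        by auto
      then have c: "X \<in> carrier_mat (Suc r) (Suc r)" by (simp add: cong_fibre_def mem_residue_mats)
      show "glue (restrict (\<lambda>j. X $$ (0, Suc j)) {..<r}, mat_delete X 0 0) = X" (is "?G = X")
      proof (rule eq_matI)
        fix i j assume "i < dim_row X" "j < dim_col X"
        then have "i < Suc r" "j < Suc r" using c by auto
        then show "?G $$ (i,j) = X $$ (i,j)"
          using X(2) c by (cases i; cases j) (auto simp: glue_def)
      qed (use c in \<open>auto simp: glue_def\<close>)
    qed
    show "glue ` (?W \<times> ?F) \<subseteq> ?S"
    proof (rule image_subsetI)
      fix a assume "a \<in> ?W \<times> ?F"
      then obtain w X where a: "a = (w, X)" and w: "w \<in> ?W" and X: "X \<in> ?F" by auto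
      have Xc: "X \<in> carrier_mat r r" using X by (simp add: cong_fibre_def mem_residue_mats)
      have col: "\<forall>i<Suc r. glue (w, X) $$ (i,0) = unit_col i mod int n" by (auto simp: glue_def)
      have ent: "glue (w, X) $$ (i,j) \<in> zmod n \<and> [glue (w, X) $$ (i,j) = Z $$ (i,j)] (mod int m)"
        if ij: "i < Suc r" "j < Suc r" for i j
      proof (cases j)
        case 0
        have "[unit_col i mod int n = unit_col i] (mod int m)"
          using n(2) by (auto simp: cong_def mod_mod_cancel)
        then have "[unit_col i mod int n = Z $$ (i,0)] (mod int m)"
          using cong_sym[OF Z0[OF ij(1)]] by (rule cong_trans)
        then show ?thesis using 0 ij zm by (auto simp: glue_def)
      next
        case (Suc j')
        show ?thesis
        proof (cases i)
          case 0
          then show ?thesis using Suc ij w by (auto simp: glue_def lifts_def PiE_iff)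
        next
          case (Suc i')
          then show ?thesis using \<open>j = Suc j'\<close> ij X Z
            by (auto simp: glue_def cong_fibre_def mem_residue_mats mat_cong_def)
        qed
      qed
      have "[det (glue (w, X)) = c] (mod int n)"
        by (rule cong_trans[OF det_eq[OF carr col, unfolded md[OF Xc]]]) (use X in \<open>simp add: cong_fibre_def\<close>)
      then show "glue a \<in> ?S"
        using col ent carr by (auto simp: a cong_fibre_def mem_residue_mats mat_cong_def)
    qed
    show "(\<lambda>X. (restrict (\<lambda>j. X $$ (0, Suc j)) {..<r}, mat_delete X 0 0)) ` ?S \<subseteq> ?W \<times> ?F"
    proof (rule image_subsetI)
      fix X assume "X \<in> ?S"
      then have X: "X \<in> residue_mats (Suc r) n" "[det X = c] (mod int n)" "mat_cong (Suc r) (int m) X Z"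
        "\<forall>i<Suc r. X $$ (i,0) = unit_col i mod int n" by (auto simp: cong_fibre_def)
      have Xc: "X \<in> carrier_mat (Suc r) (Suc r)" using X by (simp add: mem_residue_mats)
      have "[det (mat_delete X 0 0) = c] (mod int n)"
        using cong_sym[OF det_eq[OF Xc X(4)]] X(2) by (rule cong_trans)
      moreover have "mat_delete X 0 0 \<in> carrier_mat r r"
        using mat_delete_carrier[OF Xc, of 0 0] by simp
      ultimately show "(restrict (\<lambda>j. X $$ (0, Suc j)) {..<r}, mat_delete X 0 0) \<in> ?W \<times> ?F"
        using X Xc Z by (auto simp: cong_fibre_def mem_residue_mats mat_cong_def lifts_def)
    qed
  qed
  then have "card ?S = card (?W \<times> ?F)" by (rule bij_betw_same_card[symmetric])
  also have "\<dots> = p ^ r * card ?F"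
    using assms(2) by (simp add: n_def card_cartesian_product card_PiE card_lifts)
  finally show ?thesis .
qed

text \<open>Complete \<open>v\<close> to a matrix \<open>P\<close> invertible modulo
  \<open>n\<close>. Multiplication by its inverse \<open>Q\<close> turns the column \<open>v\<close>
  into the standard one and scales determinants by \<open>det Q\<close>, so the preceding count
  applies. The new \<open>c'\<close> and \<open>Y'\<close> depend on the choice of \<open>P\<close>;
  the induction only needs that they satisfy the same hypotheses in size \<open>r\<close>.\<close>

lemma card_cong_fibre_col:
  fixes p m r :: nat and Y :: "int mat"
  defines "n \<equiv> m * p"
  assumes "m \<ge> 1" "p \<ge> 1" and Y: "Y \<in> carrier_mat (Suc r) (Suc r)"
    and c: "coprime c (int n)" and dY: "[det Y = c] (mod int m)"
    and v: "\<And>i. i < Suc r \<Longrightarrow> v i \<in> lifts n m (Y $$ (i,0))"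
    and uni: "\<And>q. q dvd int n \<Longrightarrow> \<forall>i<Suc r. q dvd v i \<Longrightarrow> is_unit q"
  shows "\<exists>c' Y'. coprime c' (int n) \<and> Y' \<in> carrier_mat r r \<and> [det Y' = c'] (mod int m) \<and>
    card {X \<in> cong_fibre (Suc r) n m c Y. \<forall>i<Suc r. X $$ (i,0) = v i} =
    p ^ r * card (cong_fibre r n m c' Y')"
proof -
  have n: "n \<ge> 1" "int m dvd int n" using assms by auto
  obtain P where P: "P \<in> carrier_mat (Suc r) (Suc r)" "coprime (det P) (int n)"
    "\<forall>i<Suc r. P $$ (i,0) = v i"
    using mat_with_unimodular_column[of "Suc r" n v] uni by auto
  obtain Q where Q: "Q \<in> carrier_mat (Suc r) (Suc r)"
    "mat_cong (Suc r) (int n) (Q * P) (1\<^sub>m (Suc r))" "mat_cong (Suc r) (int n) (P * Q) (1\<^sub>m (Suc r))"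
    using mat_inverse_mod[OF P(1,2)] by blast
  let ?c = "det Q * c"
  let ?Z = "Q * Y"
  have Z: "?Z \<in> carrier_mat (Suc r) (Suc r)" using Q Y by simp
  have dQP: "[det P * det Q = 1] (mod int n)"
    using det_cong[OF _ _ Q(3)] P Q by (simp add: det_mult)
  then have "coprime (det Q) (int n)" by (metis coprime_iff_invertible_int mult.commute)
  with c have cc: "coprime ?c (int n)" by simp
  \<comment> \<open>Needed for two moduli: \<open>k = m\<close> for the matrix \<open>Y\<close>
    below, and \<open>k = n\<close> for the matrices in the fibre over it.\<close>
  have QP0: "[(Q * X) $$ (i,0) = unit_col i] (mod k)"
    if "k dvd int n" "X \<in> carrier_mat (Suc r) (Suc r)" "i < Suc r"
      "\<And>i. i < Suc r \<Longrightarrow> [X $$ (i,0) = v i] (mod k)" for X i k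
  proof -
    have "[(Q * X) $$ (i,0) = (Q * P) $$ (i,0)] (mod k)"
      using that P Q by (simp only: index_mat_mult zero_less_Suc) (intro cong_sum cong_mult, auto)
    also have "[(Q * P) $$ (i,0) = 1\<^sub>m (Suc r) $$ (i,0)] (mod k)"
      using Q(2)[unfolded mat_cong_def, rule_format, OF that(3) zero_less_Suc] that(1)
      by (rule cong_dvd_modulus)
    finally show ?thesis using that by (auto simp: unit_col_def)
  qed
  have Z0: "[?Z $$ (i,0) = unit_col i] (mod int m)" if "i < Suc r" for i
    using that v n Y by (intro QP0) (auto simp: lifts_def cong_sym_eq)
  have "[det ?Z = ?c] (mod int m)" using Q Y dY by (simp add: det_mult cong_scalar_left)
  then have "[det (mat_delete ?Z 0 0) = ?c] (mod int m)"
    using det_cong_mat_delete[OF Z, of "int m"] Z0 by (meson cong_sym cong_trans)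
  moreover have "mat_delete ?Z 0 0 \<in> carrier_mat r r"
    using mat_delete_carrier[OF Z, of 0 0] by simp
  moreover have "card {X \<in> cong_fibre (Suc r) n m c Y. \<forall>i<Suc r. X $$ (i,0) = v i} =
      card {X \<in> cong_fibre (Suc r) n m ?c ?Z. \<forall>i<Suc r. X $$ (i,0) = unit_col i mod int n}"
    (is "card ?S = card ?T")
  \<comment> \<open>Here \<open>Q\<close> is the multiplier and \<open>P\<close> its inverse, which
    is why the two inverse relations are supplied in exchanged order.\<close>
  proof (rule bij_betw_same_card[OF bij_betw_mat_mod_mult[OF n(1) Q(1) P(1) Q(3,2)]])
    show "?S \<subseteq> residue_mats (Suc r) n" "?T \<subseteq> residue_mats (Suc r) n"
      by (auto simp: cong_fibre_def)
    fix X
    show "mat_mod n (Q * X) \<in> ?T" if XS: "X \<in> ?S"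
    proof -
      have X: "X \<in> carrier_mat (Suc r) (Suc r)" "[det X = c] (mod int n)"
        "mat_cong (Suc r) (int m) X Y" "\<And>i. i < Suc r \<Longrightarrow> X $$ (i,0) = v i"
        using XS by (auto simp: cong_fibre_def mem_residue_mats)
      have QX: "Q * X \<in> carrier_mat (Suc r) (Suc r)" using Q X by simp
      note M = mat_cong_mat_mod[OF QX, of n]
      have "[det (mat_mod n (Q * X)) = det (Q * X)] (mod int n)"
        using QX by (intro det_cong[OF _ _ M]) auto
      also have "[det (Q * X) = ?c] (mod int n)" using Q X by (simp add: det_mult cong_scalar_left)
      finally have "[det (mat_mod n (Q * X)) = ?c] (mod int n)" .
      moreover have "mat_cong (Suc r) (int m) (mat_mod n (Q * X)) ?Z"
        using mat_cong_trans[OF mat_cong_dvd[OF M n(2)] mat_cong_mult[OF Q(1) X(1) Q(1) Y mat_cong_refl X(3)]] .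
      moreover have "mat_mod n (Q * X) $$ (i,0) = unit_col i mod int n" if "i < Suc r" for i
        using QP0[OF dvd_refl X(1) that] X(4) QX that by (simp add: cong_def)
      ultimately show ?thesis using mat_mod_residue[OF n(1) QX] by (simp add: cong_fibre_def)
    qed
    show "mat_mod n (P * X) \<in> ?S" if XT: "X \<in> ?T"
    proof -
      have X: "X \<in> carrier_mat (Suc r) (Suc r)" "[det X = ?c] (mod int n)"
        "mat_cong (Suc r) (int m) X ?Z" "\<And>i. i < Suc r \<Longrightarrow> X $$ (i,0) = unit_col i mod int n"
        using XT by (auto simp: cong_fibre_def mem_residue_mats)
      have PX: "P * X \<in> carrier_mat (Suc r) (Suc r)" using P X by simp
      note M = mat_cong_mat_mod[OF PX, of n]
      have "[det (mat_mod n (P * X)) = det (P * X)] (mod int n)"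
        using PX by (intro det_cong[OF _ _ M]) auto
      also have "[det (P * X) = det P * ?c] (mod int n)"
        using P X by (simp add: det_mult cong_scalar_left)
      also have "[det P * ?c = 1 * c] (mod int n)"
        unfolding mult.assoc[symmetric] by (intro cong_mult dQP) auto
      finally have "[det (mat_mod n (P * X)) = c] (mod int n)" by simp
      moreover have "mat_cong (Suc r) (int m) (mat_mod n (P * X)) Y"
      proof -
        have "mat_cong (Suc r) (int m) (mat_mod n (P * X)) (P * X)"
          by (rule mat_cong_dvd[OF M n(2)])
        also have "mat_cong (Suc r) (int m) \<dots> (P * ?Z)"
          using P X Z by (intro mat_cong_mult) auto
        also have "P * ?Z = (P * Q) * Y" using P Q Y by simp
        also have "mat_cong (Suc r) (int m) \<dots> (1\<^sub>m (Suc r) * Y)"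
          using P Q Y n by (intro mat_cong_mult mat_cong_dvd[OF Q(3)]) auto
        finally show ?thesis using Y by simp
      qed
      moreover have "mat_mod n (P * X) $$ (i,0) = v i" if i: "i < Suc r" for i
      proof -
        have "(P * X) $$ (i,0) = (\<Sum>k<Suc r. P $$ (i,k) * X $$ (k,0))"
          using P X i by (intro index_mat_mult) auto
        also have "[\<dots> = (\<Sum>k<Suc r. P $$ (i,k) * unit_col k)] (mod int n)"
          using X(4) by (intro cong_sum cong_mult) (auto simp: cong_def)
        also have "(\<Sum>k<Suc r. P $$ (i,k) * unit_col k) = v i"
          using P(3) i by (subst sum.lessThan_Suc_shift) (simp add: unit_col_def)
        finally show ?thesis using v[OF i] PX i by (auto simp: cong_def lifts_def zmod_def)
      qed
      ultimately show ?thesis using mat_mod_residue[OF n(1) PX] by (simp add: cong_fibre_def)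
    qed
  qed
  moreover note card_cong_fibre_unit_col[OF assms(2,3) Z Z0, of ?c, folded n_def]
  ultimately show ?thesis
    using cc by (intro exI[of _ ?c] exI[of _ "mat_delete ?Z 0 0"] conjI) (assumption | rule trans)+
qed

text \<open>Sort the fibre by first column. A common divisor of \<open>m\<close> and the entries of
  a lifted column divides \<open>det Y\<close> modulo \<open>m\<close>, hence is a unit, so a lift
  is unimodular modulo \<open>m * p\<close> unless \<open>p\<close> divides all its entries. Each
  remaining column contributes \<open>p ^ r\<close> times the count in size \<open>r\<close>, which
  depends on neither \<open>c\<close> nor \<open>Y\<close>. In size 1 the determinant fixes the only
  entry, so the product starts at 2.\<close>

lemma card_cong_fibre:
  fixes p m r :: nat and Y :: "int mat"
  assumes "m \<ge> 1" "prime p" "r \<ge> 1" and "Y \<in> carrier_mat r r"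
    and "coprime c (int (m * p))" and "[det Y = c] (mod int m)"
  shows "card (cong_fibre r (m * p) m c Y) =
    (\<Prod>i=2..r. p ^ (i - 1) * (p ^ i - (if p dvd m then 0 else 1)))"
  using assms(3-)
proof (induction r arbitrary: c Y rule: dec_induct)
  case base
  have n: "m * p \<ge> 1" using assms prime_gt_0_nat[of p] by auto
  have "cong_fibre 1 (m * p) m c Y = {mat 1 1 (\<lambda>_. c mod int (m * p))}" (is "_ = {?C}")
  proof (intro equalityI subsetI)
    fix X assume "X \<in> cong_fibre 1 (m * p) m c Y"
    then have X: "X \<in> residue_mats 1 (m * p)" "[det X = c] (mod int (m * p))"
      by (auto simp: cong_fibre_def)
    then have "X \<in> carrier_mat 1 1" by (simp add: mem_residue_mats)
    then have "det X = X $$ (0,0)" by (rule det_single)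
    then have "X = ?C"
      using X by (intro eq_matI) (auto simp: mem_residue_mats zmod_def cong_def)
    then show "X \<in> {?C}" by simp
  next
    fix X assume "X \<in> {?C}"
    then have X: "X = ?C" by simp
    have "det ?C = c mod int (m * p)" "det Y = Y $$ (0,0)"
      using base by (simp_all add: det_single)
    then show "X \<in> cong_fibre 1 (m * p) m c Y"
      using base n unfolding X
      by (auto simp: cong_fibre_def mem_residue_mats zmod_def mat_cong_def cong_def mod_mod_cancel
          simp del: of_nat_mult)
  qed
  then show ?case by simp
next
  case (step r)
  let ?n = "m * p"
  \<comment> \<open>The number of lifts of the first column that vanish modulo \<open>p\<close>;
    \<open>?V\<close> collects all lifts and \<open>?B\<close> these bad ones.\<close>
  let ?\<epsilon> = "if p dvd m then 0 else 1 :: nat"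
  let ?N = "\<lambda>r. \<Prod>i=2..r. p ^ (i - 1) * (p ^ i - ?\<epsilon>)"
  let ?F = "cong_fibre (Suc r) ?n m c Y"
  let ?V = "PiE {..<Suc r} (\<lambda>i. lifts ?n m (Y $$ (i,0)))"
  let ?B = "PiE {..<Suc r} (\<lambda>i. {x \<in> lifts ?n m (Y $$ (i,0)). int p dvd x})"
  let ?col = "\<lambda>X. restrict (\<lambda>i. X $$ (i,0)) {..<Suc r}"
  have p: "p \<ge> 1" "\<not> is_unit (int p)" using assms prime_gt_1_nat[of p] by auto
  have cp: "\<not> int p dvd c"
    using step.prems(2) p(2) by (meson coprime_common_divisor dvd_triv_right of_nat_dvd_iff)
  have cm: "coprime c (int m)" using step.prems(2) by simp
  have B: "v \<in> ?B \<longleftrightarrow> v \<in> ?V \<and> (\<forall>i<Suc r. int p dvd v i)" for v by (auto simp: PiE_iff)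
  \<comment> \<open>If \<open>p\<close> divides \<open>m\<close>, a bad lift would force
    \<open>p\<close> to divide the first column of \<open>Y\<close>, then \<open>det Y\<close>, then
    \<open>c\<close>. Otherwise every entry has exactly one lift divisible by
    \<open>p\<close>.\<close>
  have "card ?B = ?\<epsilon>"
  proof (cases "p dvd m")
    case True
    have "?B = {}"
    proof (rule equals0I)
      fix v assume v: "v \<in> ?B"
      have "int p dvd Y $$ (i,0)" if "i < Suc r" for i
      proof -
        have "int p dvd v i" "[v i = Y $$ (i,0)] (mod int m)" using v that
          by (auto simp: PiE_iff lifts_def)
        then show ?thesis using True by (metis cong_dvd_iff cong_dvd_modulus of_nat_dvd_iff)
      qed
      then have "int p dvd det Y" using step.prems(1) by (intro dvd_det_if_dvd_column[of Y "Suc r" 0]) auto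
      then show False using cp step.prems(3) True by (metis cong_dvd_iff cong_dvd_modulus of_nat_dvd_iff)
    qed
    then show ?thesis using True by simp
  next
    case False
    then have "coprime m p" using assms(2) by (metis coprime_commute prime_imp_coprime)
    then show ?thesis using False assms p by (simp add: card_PiE card_lifts_dvd del: of_nat_mult)
  qed
  moreover have "?B \<subseteq> ?V" using B by blast
  moreover have "finite ?V" by (intro finite_PiE) auto
  moreover have "card ?V = p ^ Suc r" using assms by (simp add: card_PiE card_lifts)
  ultimately have cardV: "card (?V - ?B) = p ^ Suc r - ?\<epsilon>" and finV: "finite (?V - ?B)"
    by (auto simp: card_Diff_subset finite_subset)
  have "card ?F = (\<Sum>v\<in>?V - ?B. card {X \<in> ?F. ?col X = v})"
  proof -
    \<comment> \<open>The determinant of a member is congruent to \<open>c\<close> modulo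
      \<open>p\<close>, hence not divisible by \<open>p\<close>, so its first column cannot vanish
      there.\<close>
    have col: "?col X \<in> ?V - ?B" if X: "X \<in> ?F" for X
    proof -
      have X': "X \<in> carrier_mat (Suc r) (Suc r)" "[det X = c] (mod int p)"
        using X by (auto simp: cong_fibre_def mem_residue_mats intro: cong_dvd_modulus)
      have "?col X \<in> ?V"
        using X by (auto simp: cong_fibre_def mem_residue_mats mat_cong_def lifts_def)
      moreover have False if "?col X \<in> ?B"
      proof -
        have "int p dvd det X" using that X' unfolding B
          by (intro dvd_det_if_dvd_column[of X "Suc r" 0]) auto
        then show False using cp X'(2) by (simp add: cong_dvd_iff)
      qed
      ultimately show ?thesis by blast
    qed
    have "(\<Sum>v\<in>?V - ?B. \<Sum>X\<in>{X \<in> ?F. ?col X = v}. 1) = (\<Sum>X\<in>?F. 1::nat)"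
      by (rule sum.group[OF finite_cong_fibre finV]) (use col in blast)
    then show ?thesis by simp
  qed
  also have "\<dots> = (\<Sum>v\<in>?V - ?B. p ^ r * ?N r)"
  proof (rule sum.cong[OF refl])
    fix v assume v: "v \<in> ?V - ?B"
    \<comment> \<open>A common divisor \<open>q\<close> is coprime to \<open>m\<close>, so it
      divides the prime \<open>p\<close>; were it not a unit, \<open>p\<close> would divide the
      whole column.\<close>
    have "is_unit q" if q: "q dvd int ?n" "\<forall>i<Suc r. q dvd v i" for q
    proof -
      have "coprime q (int m)"
      proof (rule coprimeI)
        fix d assume d: "d dvd q" "d dvd int m"
        have "d dvd Y $$ (i,0)" if "i < Suc r" for i
        proof -
          have "d dvd v i" using d(1) q(2) that by (meson dvd_trans)
          moreover have "[v i = Y $$ (i,0)] (mod int m)" using v that by (auto simp: PiE_iff lifts_def)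
          ultimately show ?thesis using d(2) by (metis cong_dvd_iff cong_dvd_modulus)
        qed
        then have "d dvd det Y" using step.prems(1)
          by (intro dvd_det_if_dvd_column[of Y "Suc r" 0]) auto
        then have "d dvd c" using step.prems(3) d(2) by (metis cong_dvd_iff cong_dvd_modulus)
        then show "is_unit d" using cm d(2) by (meson coprime_common_divisor)
      qed
      then have "q dvd int p" using q(1) by (simp add: coprime_dvd_mult_right_iff)
      moreover have "prime (int p)" using assms by simp
      ultimately have "is_unit q \<or> int p dvd q" by (meson prime_elem_imp_irreducible irreducibleD' prime_imp_prime_elem)
      moreover have "\<not> int p dvd q"
      proof
        assume "int p dvd q"
        then have "\<forall>i<Suc r. int p dvd v i" using q(2) by (meson dvd_trans)
        then show False using v B by blast
      qed
      ultimately show ?thesis by blast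
    qed
    moreover have "v i \<in> lifts ?n m (Y $$ (i,0))" if "i < Suc r" for i using v that by auto
    ultimately obtain c' Y' where c': "coprime c' (int ?n)" "Y' \<in> carrier_mat r r"
      "[det Y' = c'] (mod int m)"
      "card {X \<in> ?F. \<forall>i<Suc r. X $$ (i,0) = v i} = p ^ r * card (cong_fibre r ?n m c' Y')"
      using card_cong_fibre_col[OF assms(1) p(1) step.prems(1,2,3), of v] by blast
    have "{X \<in> ?F. ?col X = v} = {X \<in> ?F. \<forall>i<Suc r. X $$ (i,0) = v i}"
      using v by (auto simp: PiE_iff extensional_def fun_eq_iff restrict_def)
    then show "card {X \<in> ?F. ?col X = v} = p ^ r * ?N r"
      using c' step.IH by simp
  qed
  also have "\<dots> = ?N (Suc r)" using step.hyps cardV by (simp add: atLeastAtMostSuc_conv del: power_Suc)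
  finally show ?case .
qed

subsection \<open>Lifting the modulus\<close>

lemma mat_trace_cong:
  assumes "A \<in> carrier_mat r r" "B \<in> carrier_mat r r" "mat_cong r n A B"
  shows "[mat_trace A = mat_trace B] (mod n)"
  unfolding mat_trace_def using assms by (auto simp: mat_cong_def intro!: cong_sum)

text \<open>The exponents \<open>(i - 1) + i\<close> for \<open>i\<close> from 2 to \<open>r\<close>
  add up to \<open>r\<^sup>2 - 1\<close>. The parameter \<epsilon> covers both cases of the count,
  and its bound keeps the subtraction of naturals exact.\<close>

lemma card_factor_eq:
  fixes p r :: nat
  assumes "p \<ge> 1" "r \<ge> 1" "\<epsilon> \<le> 1"
  shows "of_nat (\<Prod>i=2..r. p ^ (i - 1) * (p ^ i - \<epsilon>)) =
    (of_nat p ^ (r\<^sup>2 - 1) * (\<Prod>i=2..r. 1 - of_nat \<epsilon> / of_nat p ^ i) :: complex)"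
  using assms(2)
proof (induction r rule: dec_induct)
  case (step r)
  have "p ^ Suc r \<ge> \<epsilon>" using assms by (meson le_trans one_le_power)
  then have fac: "(of_nat (p ^ r * (p ^ Suc r - \<epsilon>)) :: complex) =
      of_nat p ^ r * of_nat p ^ Suc r * (1 - of_nat \<epsilon> / of_nat p ^ Suc r)"
    using assms(1) by (simp add: of_nat_diff algebra_simps)
  have ins: "{2..Suc r} = insert (Suc r) {2..r}" using step.hyps by auto
  have "(Suc r)\<^sup>2 - 1 = r + Suc r + (r\<^sup>2 - 1)"
    using step.hyps by (simp add: power2_eq_square)
  then have pw: "(of_nat p :: complex) ^ ((Suc r)\<^sup>2 - 1) =
      of_nat p ^ r * of_nat p ^ Suc r * of_nat p ^ (r\<^sup>2 - 1)"
    by (simp only: power_add)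
  have "of_nat (\<Prod>i=2..Suc r. p ^ (i - 1) * (p ^ i - \<epsilon>)) =
      (of_nat (p ^ r * (p ^ Suc r - \<epsilon>)) * of_nat (\<Prod>i=2..r. p ^ (i - 1) * (p ^ i - \<epsilon>)) :: complex)"
    unfolding ins by (simp del: power_Suc of_nat_prod)
  then show ?case
    unfolding fac step.IH pw ins by (simp add: mult_ac del: power_Suc)
qed simp

text \<open>Group the matrices by their reduction modulo \<open>m\<close>. The summand is constant
  on each class because the trace is compatible with reduction, and all classes have the size
  computed in \<open>card_cong_fibre\<close> with \<open>c = 1\<close>.\<close>

lemma SL_gauss_sum_lift_prime:
  assumes "m \<ge> 1" "prime p" "r \<ge> 1"
  shows "SL_gauss_sum r (m * p) (\<lambda>x. \<mu> (x mod int m)) =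
    of_nat p ^ (r\<^sup>2 - 1) * (if p dvd m then 1 else \<Prod>i=2..r. 1 - 1 / of_nat p ^ i) *
    SL_gauss_sum r m \<mu>"
proof -
  let ?n = "m * p"
  let ?N = "\<Prod>i=2..r. p ^ (i - 1) * (p ^ i - (if p dvd m then 0 else 1))"
  have mn: "int m dvd int ?n" by simp
  have p: "p \<ge> 1" using assms prime_gt_0_nat[of p] by auto
  have fibre: "{X \<in> SL r ?n. mat_mod m X = Y} = cong_fibre r ?n m 1 Y" if Y: "Y \<in> SL r m" for Y
  proof -
    have "mat_mod m X = Y \<longleftrightarrow> mat_cong r (int m) X Y" if X: "X \<in> SL r ?n" for X
    proof -
      have c: "X \<in> carrier_mat r r" using X by (simp add: SL_eq mem_residue_mats)
      note M = mat_cong_mat_mod[OF c, of m]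
      show ?thesis
      proof
        assume "mat_mod m X = Y"
        then show "mat_cong r (int m) X Y" using mat_cong_sym[OF M] by simp
      next
        assume "mat_cong r (int m) X Y"
        then have "mat_cong r (int m) (mat_mod m X) Y" using M by (blast intro: mat_cong_trans)
        then show "mat_mod m X = Y"
          using Y mat_mod_residue[OF assms(1) c] by (intro residue_mats_eqI) (auto simp: SL_eq)
      qed
    qed
    then show ?thesis by (auto simp: SL_eq cong_fibre_def)
  qed
  have "mat_mod m X \<in> SL r m" if X: "X \<in> SL r ?n" for X
  proof -
    have c: "X \<in> carrier_mat r r" using X by (simp add: SL_eq mem_residue_mats)
    have "[det (mat_mod m X) = det X] (mod int m)"
      using c by (intro det_cong mat_cong_mat_mod) auto
    moreover have "[det X = 1] (mod int m)"
      using X mn unfolding SL_eq by (auto intro: cong_dvd_modulus)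
    ultimately have "[det (mat_mod m X) = 1] (mod int m)" by (rule cong_trans)
    then show ?thesis
      using mat_mod_residue[OF assms(1) c] by (simp add: SL_eq)
  qed
  then have "SL_gauss_sum r ?n (\<lambda>x. \<mu> (x mod int m)) = (\<Sum>Y\<in>SL r m.
      \<Sum>X\<in>{X \<in> SL r ?n. mat_mod m X = Y}. \<mu> (mat_trace X mod int ?n mod int m))"
    unfolding SL_gauss_sum_def by (subst sum.group) auto
  also have "\<dots> = (\<Sum>Y\<in>SL r m. of_nat ?N * \<mu> (mat_trace Y mod int m))"
  proof (rule sum.cong[OF refl])
    fix Y assume Y: "Y \<in> SL r m"
    have Yc: "Y \<in> carrier_mat r r" "[det Y = 1] (mod int m)" using Y by (auto simp: SL_eq mem_residue_mats)
    have "mat_trace X mod int ?n mod int m = mat_trace Y mod int m"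
      if "X \<in> cong_fibre r ?n m 1 Y" for X
    proof -
      have "[mat_trace X = mat_trace Y] (mod int m)"
        using that Yc by (intro mat_trace_cong[of _ r]) (auto simp: cong_fibre_def mem_residue_mats)
      then show ?thesis by (simp add: cong_def mod_mod_cancel)
    qed
    then have "(\<Sum>X\<in>cong_fibre r ?n m 1 Y. \<mu> (mat_trace X mod int ?n mod int m)) =
        (\<Sum>X\<in>cong_fibre r ?n m 1 Y. \<mu> (mat_trace Y mod int m))"
      by (intro sum.cong) auto
    then show "(\<Sum>X\<in>{X \<in> SL r ?n. mat_mod m X = Y}. \<mu> (mat_trace X mod int ?n mod int m)) =
        of_nat ?N * \<mu> (mat_trace Y mod int m)"
      using card_cong_fibre[OF assms Yc(1) _ Yc(2)] unfolding fibre[OF Y] by simp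
  qed
  also have "\<dots> = of_nat ?N * SL_gauss_sum r m \<mu>"
    by (simp add: SL_gauss_sum_def sum_distrib_left)
  finally show ?thesis
    using card_factor_eq[OF p assms(3), of "if p dvd m then 0 else 1"]
    by (cases "p dvd m") (simp_all del: of_nat_prod)
qed

text \<open>Induction over the prime factors of \<open>d\<close>, for all \<open>m\<close> and \<mu>
  together: the modulus first grows from \<open>m\<close> to \<open>m * p\<close>, and the rest of
  \<open>d\<close> is handled over \<open>m * p\<close>. A prime yields a local factor only when it
  first enters the modulus.\<close>

lemma SL_gauss_sum_lift:
  fixes m d r :: nat
  assumes "m \<ge> 1" "d \<ge> 1" "r \<ge> 1"
  shows "SL_gauss_sum r (m * d) (\<lambda>x. \<mu> (x mod int m)) = of_nat d ^ (r\<^sup>2 - 1) *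
    (\<Prod>p \<in> {p. prime p \<and> p dvd m * d \<and> \<not> p dvd m}. \<Prod>i=2..r. 1 - 1 / of_nat p ^ i) *
    SL_gauss_sum r m \<mu>"
  using assms(1,2)
proof (induction d arbitrary: m \<mu> rule: prime_divisors_induct)
  case (unit d)
  then have "d = 1" by simp
  have "{p. prime p \<and> p dvd m * d \<and> \<not> p dvd m} = {}" using \<open>d = 1\<close> by auto
  then show ?case using \<open>d = 1\<close>
    by (simp add: SL_gauss_sum_def)
next
  case (factor p d)
  let ?S = "\<lambda>m n. {q. prime q \<and> q dvd n \<and> \<not> q dvd m}"
  let ?g = "\<lambda>p. \<Prod>i=2..r. 1 - 1 / of_nat p ^ i :: complex"
  let ?c = "if p dvd m then 1 else ?g p"
  have mp: "m * p \<ge> 1" "d \<ge> 1" using factor.prems factor.hyps by (auto simp: Suc_le_eq prime_gt_0_nat)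
  \<comment> \<open>The function is rewritten as one factoring through residues modulo
    \<open>m * p\<close>, the form in which the induction hypothesis takes it.\<close>
  have "SL_gauss_sum r (m * (p * d)) (\<lambda>x. \<mu> (x mod int m)) =
      SL_gauss_sum r (m * p * d) (\<lambda>x. (\<lambda>y. \<mu> (y mod int m)) (x mod int (m * p)))"
    by (simp add: mod_mod_cancel mult.assoc)
  also have "\<dots> = of_nat d ^ (r\<^sup>2 - 1) * prod ?g (?S (m * p) (m * p * d)) *
      (of_nat p ^ (r\<^sup>2 - 1) * ?c * SL_gauss_sum r m \<mu>)"
    unfolding factor.IH[OF mp, of "\<lambda>y. \<mu> (y mod int m)"]
      SL_gauss_sum_lift_prime[OF factor.prems(1) factor.hyps assms(3), of \<mu>] ..
  finally have red: "SL_gauss_sum r (m * (p * d)) (\<lambda>x. \<mu> (x mod int m)) = \<dots>" .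
  have dvd: "q dvd p * d \<longleftrightarrow> q = p \<or> q dvd d" "q dvd m * l \<longleftrightarrow> q dvd m \<or> q dvd l"
      "q dvd p \<longleftrightarrow> q = p" if "prime q" for q l
    using that factor.hyps primes_dvd_imp_eq[of q p] by (auto simp: prime_dvd_mult_iff)
  have fac: "prod ?g (?S m (m * (p * d))) = ?c * prod ?g (?S (m * p) (m * p * d))"
  proof (cases "p dvd m")
    case True
    then have "?S m (m * (p * d)) = ?S (m * p) (m * p * d)"
      using dvd by (auto simp: mult.assoc)
    then show ?thesis using True by simp
  next
    case False
    then have "?S m (m * (p * d)) = insert p (?S (m * p) (m * p * d))"
      using dvd factor.hyps by (auto simp: mult.assoc)
    moreover have "finite (?S (m * p) (m * p * d))"
      using mp by (intro finite_subset[OF _ finite_divisors_nat[of "m * p * d"]]) auto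
    ultimately show ?thesis using False by simp
  qed
  show ?case unfolding red fac by (simp add: power_mult_distrib mult_ac)
qed simp

subsection \<open>Primitive characters\<close>

text \<open>Positions above the diagonal; with coordinates exchanged they are the positions below
  it.\<close>

definition upper_pairs :: "nat \<Rightarrow> (nat \<times> nat) set" where
  "upper_pairs r = {ij \<in> {..<r} \<times> {..<r}. fst ij < snd ij}"

text \<open>The diagonal \<open>x\<close> is indexed from 1, as in the Kloosterman sum, whereas
  matrix indices start at 0. With \<open>x\<close> constantly 1 this is a unitriangular
  matrix.\<close>

definition upper_mat :: "nat \<Rightarrow> (nat \<Rightarrow> int) \<Rightarrow> (nat \<times> nat \<Rightarrow> int) \<Rightarrow> int mat" where
  "upper_mat r x t =
     mat r r (\<lambda>(i,j). if i = j then x (Suc i) else if i < j then t (i,j) else 0)"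

lemma finite_upper_pairs [simp]: "finite (upper_pairs r)"
  by (simp add: upper_pairs_def)

lemma card_upper_pairs: "card (upper_pairs r) = r * (r - 1) div 2"
proof -
  have "upper_pairs r = (SIGMA j:{..<r}. {..<j})\<inverse>"
    by (auto simp: upper_pairs_def)
  then have "card (upper_pairs r) = (\<Sum>j<r. j)"
    by (simp add: card_SigmaI)
  also have "\<dots> = r * (r - 1) div 2"
    by (simp add: Sum_Ico_nat flip: atLeast0LessThan)
  finally show ?thesis .
qed

lemma upper_mat_carrier [simp]: "upper_mat r x t \<in> carrier_mat r r"
  by (simp add: upper_mat_def)

lemma index_upper_mat [simp]:
  "i < r \<Longrightarrow> j < r \<Longrightarrow>
    upper_mat r x t $$ (i,j) = (if i = j then x (Suc i) else if i < j then t (i,j) else 0)"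
  by (simp add: upper_mat_def)

lemma prod_list_diag_mat:
  "A \<in> carrier_mat r r \<Longrightarrow> prod_list (diag_mat A) = (\<Prod>i<r. A $$ (i,i))"
  by (auto simp: prod_list_diag_prod atLeast0LessThan)

lemma det_upper_mat: "det (upper_mat r x t) = (\<Prod>i=1..r. x i)"
proof -
  have "upper_triangular (upper_mat r x t)"
    by (auto simp: upper_mat_def)
  then have "det (upper_mat r x t) = (\<Prod>i<r. upper_mat r x t $$ (i,i))"
    using det_upper_triangular[of "upper_mat r x t" r] prod_list_diag_mat[of "upper_mat r x t" r]
    by simp
  also have "\<dots> = (\<Prod>i<r. x (Suc i))" by (intro prod.cong) auto
  also have "\<dots> = (\<Prod>i=1..r. x i)"
    by (rule prod.reindex_bij_witness[of _ "\<lambda>i. i - 1" Suc]) auto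
  finally show ?thesis .
qed

lemma mat_trace_upper_mat: "mat_trace (upper_mat r x t) = (\<Sum>i=1..r. x i)"
proof -
  have "mat_trace (upper_mat r x t) = (\<Sum>i<r. x (Suc i))"
    unfolding mat_trace_def by (intro sum.cong) (auto simp: upper_mat_def)
  also have "\<dots> = (\<Sum>i=1..r. x i)"
    by (rule sum.reindex_bij_witness[of _ "\<lambda>i. i - 1" Suc]) auto
  finally show ?thesis .
qed

text \<open>The trace of a product pairs position \<open>(i,k)\<close> of the left factor with
  \<open>(k,i)\<close> of the right one, so each free entry above the diagonal tests one entry of
  \<open>X\<close> below it.\<close>

lemma mat_trace_unitriangular_mult:
  assumes X: "X \<in> carrier_mat r r"
  shows "mat_trace (upper_mat r (\<lambda>_. 1) t * X) =
    mat_trace X + (\<Sum>ij\<in>upper_pairs r. t ij * X $$ (snd ij, fst ij))"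
proof -
  have "mat_trace (upper_mat r (\<lambda>_. 1) t * X) =
      (\<Sum>i<r. \<Sum>k<r. upper_mat r (\<lambda>_. 1) t $$ (i,k) * X $$ (k,i))"
    unfolding mat_trace_def using X index_mat_mult[OF upper_mat_carrier X]
    by (intro sum.cong) (auto simp: upper_mat_def)
  also have "\<dots> = (\<Sum>i<r. \<Sum>k<r. (if k = i then X $$ (k,i) else 0) +
      (if i < k then t (i,k) * X $$ (k,i) else 0))"
    by (intro sum.cong) auto
  also have "\<dots> = (\<Sum>i<r. X $$ (i,i)) + (\<Sum>i<r. \<Sum>k<r. if i < k then t (i,k) * X $$ (k,i) else 0)"
    by (simp add: sum.distrib)
  also have "(\<Sum>i<r. \<Sum>k<r. if i < k then t (i,k) * X $$ (k,i) else 0) =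
      (\<Sum>ij\<in>upper_pairs r. t ij * X $$ (snd ij, fst ij))"
    unfolding upper_pairs_def
    by (simp add: sum.inter_filter sum.cartesian_product case_prod_unfold cong: if_cong)
  also have "(\<Sum>i<r. X $$ (i,i)) = mat_trace X"
    using X by (auto simp: mat_trace_def)
  finally show ?thesis .
qed

section \<open>Orthogonality of additive characters\<close>

lemma add_char_sum: "add_char m a (sum f A) = (\<Prod>x\<in>A. add_char m a (f x))"
  by (induction A rule: infinite_finite_induct) (auto simp: add_char_add add_char_def[of _ _ 0])

text \<open>A geometric sum whose ratio \<open>add_char m a x\<close> is an \<open>m\<close>-th root
  of unity.\<close>

lemma sum_add_char:
  assumes "m \<ge> 1"
  shows "(\<Sum>s\<in>zmod m. add_char m a (s * x)) = (if int m dvd a * x then of_nat m else 0)"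
proof -
  have pow: "add_char m a (int k * x) = add_char m a x ^ k" for k
    by (induction k) (auto simp: add_char_add distrib_right add_char_def[of _ _ 0])
  have "add_char m a x ^ m = 1"
    using add_char_eq_1_iff[OF assms, of a "int m * x"] by (simp add: pow)
  have "(\<Sum>s\<in>zmod m. add_char m a (s * x)) = (\<Sum>k<m. add_char m a x ^ k)"
    by (rule sum.reindex_bij_witness[of _ int nat]) (auto simp: zmod_def simp flip: pow)
  also have "\<dots> = (if int m dvd a * x then of_nat m else 0)"
  proof (cases "add_char m a x = 1")
    case True
    then show ?thesis using add_char_eq_1_iff[OF assms, of a x] by simp
  next
    case False
    then have "(\<Sum>k<m. add_char m a x ^ k) = 0"
      using geometric_sum[of "add_char m a x" m] \<open>add_char m a x ^ m = 1\<close> by simp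
    then show ?thesis using False add_char_eq_1_iff[OF assms, of a x] by simp
  qed
  finally show ?thesis .
qed

definition SL_upper :: "nat \<Rightarrow> nat \<Rightarrow> int mat set" where
  "SL_upper r m = {X \<in> SL r m. \<forall>ij\<in>upper_pairs r. X $$ (snd ij, fst ij) = 0}"

text \<open>
  Left translation by a unitriangular matrix permutes \<open>SL\<close>; averaging over all of them kills
  every summand with a nonzero entry below the diagonal.
\<close>

lemma SL_gauss_sum_eq_sum_upper:
  assumes "m \<ge> 1" and cop: "coprime a (int m)"
  shows "SL_gauss_sum r m (add_char m a) = (\<Sum>X\<in>SL_upper r m. add_char m a (mat_trace X))"
proof -
  let ?\<chi> = "add_char m a" and ?I = "upper_pairs r"
  let ?T = "PiE ?I (\<lambda>_. zmod m)"
  let ?M = "of_nat m ^ card ?I :: complex"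
  have finz: "finite (zmod m)" by (simp add: zmod_def)
  have cardT: "card ?T = m ^ card ?I" by (simp add: card_PiE zmod_def)
  have SLc: "X \<in> carrier_mat r r" if "X \<in> SL r m" for X
    using that by (simp add: SL_eq mem_residue_mats)
  have G: "SL_gauss_sum r m ?\<chi> = (\<Sum>X\<in>SL r m. ?\<chi> (mat_trace X))"
    using assms by (simp add: SL_gauss_sum_def add_char_mod)
  \<comment> \<open>Substituting \<open>?U * X\<close> for \<open>X\<close> leaves the sum unchanged
    and multiplies each summand by a character value depending on \<open>t\<close>.\<close>
  have translate: "SL_gauss_sum r m ?\<chi> =
      (\<Sum>X\<in>SL r m. ?\<chi> (mat_trace X) * (\<Prod>ij\<in>?I. ?\<chi> (t ij * X $$ (snd ij, fst ij))))" for t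
  proof -
    let ?U = "upper_mat r (\<lambda>_. 1) t"
    have dU: "det ?U = 1" by (simp add: det_upper_mat)
    obtain Q where Q: "Q \<in> carrier_mat r r" "mat_cong r (int m) (Q * ?U) (1\<^sub>m r)"
      "mat_cong r (int m) (?U * Q) (1\<^sub>m r)"
      using mat_inverse_mod[OF upper_mat_carrier, of r "\<lambda>_. 1" t m] dU by auto
    \<comment> \<open>Hence multiplication by the inverse \<open>Q\<close> also preserves
      \<open>SL\<close>, as the bijection requires.\<close>
    have dQ: "[det Q = 1] (mod int m)"
      using det_cong[OF _ _ Q(2)] Q(1) dU by (simp add: det_mult[of _ r])
    have SL_mult: "mat_mod m (P * X) \<in> SL r m"
      if P: "P \<in> carrier_mat r r" "[det P = 1] (mod int m)" and X: "X \<in> SL r m" for P X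
    proof -
      have PX: "P * X \<in> carrier_mat r r" using P SLc[OF X] by simp
      have "[det (mat_mod m (P * X)) = det (P * X)] (mod int m)"
        using PX by (intro det_cong mat_cong_mat_mod) auto
      also have "det (P * X) = det P * det X" using P(1) SLc[OF X] by (rule det_mult)
      also have "[\<dots> = 1 * 1] (mod int m)"
        using P(2) X by (intro cong_mult) (auto simp: SL_eq)
      finally show ?thesis using mat_mod_residue[OF assms(1) PX] by (simp add: SL_eq)
    qed
    have bij: "bij_betw (\<lambda>X. mat_mod m (?U * X)) (SL r m) (SL r m)"
      by (rule bij_betw_mat_mod_mult[OF assms(1) upper_mat_carrier Q])
        (use Q(1) dQ dU SL_mult in \<open>simp_all add: SL_eq\<close>)
    have "SL_gauss_sum r m ?\<chi> = (\<Sum>X\<in>SL r m. ?\<chi> (mat_trace (mat_mod m (?U * X))))"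
      unfolding G by (rule sum.reindex_bij_betw[OF bij, symmetric])
    also have "\<dots> = (\<Sum>X\<in>SL r m. ?\<chi> (mat_trace (?U * X)))"
    proof (rule sum.cong[OF refl])
      fix X assume "X \<in> SL r m"
      then have UX: "?U * X \<in> carrier_mat r r" using SLc[of X] by (intro mult_carrier_mat[of _ r r]) auto
      have "[mat_trace (mat_mod m (?U * X)) = mat_trace (?U * X)] (mod int m)"
        using UX by (intro mat_trace_cong[of _ r] mat_cong_mat_mod) auto
      then show "?\<chi> (mat_trace (mat_mod m (?U * X))) = ?\<chi> (mat_trace (?U * X))"
        by (subst (1 2) add_char_mod[OF assms(1), symmetric]) (simp add: cong_def)
    qed
    also have "\<dots> = (\<Sum>X\<in>SL r m. ?\<chi> (mat_trace X) * (\<Prod>ij\<in>?I. ?\<chi> (t ij * X $$ (snd ij, fst ij))))"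
      by (intro sum.cong refl)
        (simp add: mat_trace_unitriangular_mult[OF SLc] add_char_add add_char_sum)
    finally show ?thesis .
  qed
  have "?M * SL_gauss_sum r m ?\<chi> = (\<Sum>t\<in>?T. SL_gauss_sum r m ?\<chi>)"
    by (simp add: cardT)
  also have "\<dots> = (\<Sum>t\<in>?T. \<Sum>X\<in>SL r m. ?\<chi> (mat_trace X) * (\<Prod>ij\<in>?I. ?\<chi> (t ij * X $$ (snd ij, fst ij))))"
    by (rule sum.cong[OF refl translate])
  also have "\<dots> = (\<Sum>X\<in>SL r m. ?\<chi> (mat_trace X) * (\<Sum>t\<in>?T. \<Prod>ij\<in>?I. ?\<chi> (t ij * X $$ (snd ij, fst ij))))"
    by (subst sum.swap) (simp add: sum_distrib_left)
  also have "\<dots> = (\<Sum>X\<in>SL r m. if X \<in> SL_upper r m then ?\<chi> (mat_trace X) * ?M else 0)"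
  proof (intro sum.cong refl)
    fix X assume X: "X \<in> SL r m"
    \<comment> \<open>The entries of \<open>t\<close> vary independently, so the sum of products
      splits into one complete character sum per position.\<close>
    have "(\<Sum>t\<in>?T. \<Prod>ij\<in>?I. ?\<chi> (t ij * X $$ (snd ij, fst ij))) =
        (\<Prod>ij\<in>?I. \<Sum>s\<in>zmod m. ?\<chi> (s * X $$ (snd ij, fst ij)))"
      using finz by (intro prod_sum_PiE[symmetric]) auto
    also have "\<dots> = (\<Prod>ij\<in>?I. if X $$ (snd ij, fst ij) = 0 then of_nat m else 0)"
    proof (rule prod.cong[OF refl])
      fix ij assume ij: "ij \<in> ?I"
      have "X $$ (snd ij, fst ij) \<in> zmod m"
        using X ij by (auto simp: SL_eq mem_residue_mats upper_pairs_def)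
      then have "int m dvd X $$ (snd ij, fst ij) \<longleftrightarrow> X $$ (snd ij, fst ij) = 0"
        by (auto simp: zmod_def dvd_eq_mod_eq_0)
      \<comment> \<open>Primitivity enters here: \<open>a\<close> is a unit modulo \<open>m\<close>,
        so a character sum survives only at a zero entry.\<close>
      then have "int m dvd a * X $$ (snd ij, fst ij) \<longleftrightarrow> X $$ (snd ij, fst ij) = 0"
        using cop by (simp add: coprime_dvd_mult_right_iff coprime_commute)
      then show "(\<Sum>s\<in>zmod m. ?\<chi> (s * X $$ (snd ij, fst ij))) =
          (if X $$ (snd ij, fst ij) = 0 then of_nat m else 0)"
        using sum_add_char[OF assms(1)] by simp
    qed
    also have "\<dots> = (if X \<in> SL_upper r m then ?M else 0)"
    proof (cases "X \<in> SL_upper r m")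
      case True
      then show ?thesis by (simp add: SL_upper_def)
    next
      case False
      then have "\<exists>ij\<in>?I. X $$ (snd ij, fst ij) \<noteq> 0" using X by (auto simp: SL_upper_def)
      then have "(\<Prod>ij\<in>?I. if X $$ (snd ij, fst ij) = 0 then of_nat m else (0::complex)) = 0"
        by (intro prod_zero) auto
      then show ?thesis using False by simp
    qed
    finally show "?\<chi> (mat_trace X) * (\<Sum>t\<in>?T. \<Prod>ij\<in>?I. ?\<chi> (t ij * X $$ (snd ij, fst ij))) =
        (if X \<in> SL_upper r m then ?\<chi> (mat_trace X) * ?M else 0)"
      by simp
  qed
  also have "\<dots> = (\<Sum>X\<in>{X \<in> SL r m. X \<in> SL_upper r m}. ?\<chi> (mat_trace X) * ?M)"
    by (simp add: sum.inter_filter)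
  also have "{X \<in> SL r m. X \<in> SL_upper r m} = SL_upper r m" by (auto simp: SL_upper_def)
  also have "(\<Sum>X\<in>SL_upper r m. ?\<chi> (mat_trace X) * ?M) = ?M * (\<Sum>X\<in>SL_upper r m. ?\<chi> (mat_trace X))"
    by (simp add: sum_distrib_left mult.commute)
  finally show ?thesis using assms(1) by simp
qed

text \<open>For triangular matrices the determinant condition and the trace involve the diagonal
  alone, as in the Kloosterman sum. The entries above it are free and contribute only their number
  of choices.\<close>

lemma sum_SL_upper:
  assumes "m \<ge> 1"
  shows "(\<Sum>X\<in>SL_upper r m. add_char m a (mat_trace X)) =
    of_nat m ^ (r * (r - 1) div 2) * hyper_kloosterman r m (add_char m a)"
proof -
  let ?I = "upper_pairs r"
  let ?T = "PiE ?I (\<lambda>_. zmod m)"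
  let ?D = "{x \<in> {1..r} \<rightarrow>\<^sub>E zmod m. [(\<Prod>i=1..r. x i) = 1] (mod int m)}"
  have bij: "bij_betw (\<lambda>(x, t). upper_mat r x t) (?D \<times> ?T) (SL_upper r m)"
  proof (rule bij_betw_byWitness[where
        f' = "\<lambda>X. (restrict (\<lambda>i. X $$ (i - 1, i - 1)) {1..r}, restrict (\<lambda>ij. X $$ ij) ?I)"])
    have inv: "upper_mat r (restrict (\<lambda>i. X $$ (i - 1, i - 1)) {1..r}) (restrict (\<lambda>ij. X $$ ij) ?I) = X"
      if X: "X \<in> SL_upper r m" for X
    proof (rule eq_matI)
      have c: "X \<in> carrier_mat r r" using X by (simp add: SL_upper_def SL_eq mem_residue_mats)
      fix i j assume "i < dim_row X" "j < dim_col X"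
      then have ij: "i < r" "j < r" using c by auto
      have "X $$ (i,j) = 0" if "j < i"
        using X ij that unfolding SL_upper_def upper_pairs_def by force
      then show "upper_mat r (restrict (\<lambda>i. X $$ (i - 1, i - 1)) {1..r})
          (restrict (\<lambda>ij. X $$ ij) ?I) $$ (i,j) = X $$ (i,j)"
        using ij by (auto simp: upper_pairs_def)
    qed (use X in \<open>auto simp: SL_upper_def SL_eq mem_residue_mats upper_mat_def\<close>)
    then show "\<forall>X\<in>SL_upper r m. (\<lambda>(x, t). upper_mat r x t)
        (restrict (\<lambda>i. X $$ (i - 1, i - 1)) {1..r}, restrict (\<lambda>ij. X $$ ij) ?I) = X"
      by simp
    show "\<forall>xt\<in>?D \<times> ?T. (restrict (\<lambda>i. (\<lambda>(x, t). upper_mat r x t) xt $$ (i - 1, i - 1)) {1..r},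
        restrict (\<lambda>ij. (\<lambda>(x, t). upper_mat r x t) xt $$ ij) ?I) = xt"
    proof
      fix xt assume "xt \<in> ?D \<times> ?T"
      then obtain x t where xt: "xt = (x, t)" and x: "x \<in> {1..r} \<rightarrow>\<^sub>E zmod m" and t: "t \<in> ?T" by auto
      have "restrict (\<lambda>i. upper_mat r x t $$ (i - 1, i - 1)) {1..r} = x"
        using x by (auto simp: fun_eq_iff PiE_iff extensional_def)
      moreover have "restrict (\<lambda>ij. upper_mat r x t $$ ij) ?I = t"
      proof
        fix ij show "restrict (\<lambda>ij. upper_mat r x t $$ ij) ?I ij = t ij"
          using t by (cases ij) (auto simp: upper_pairs_def PiE_iff extensional_def)
      qed
      ultimately show "(restrict (\<lambda>i. (\<lambda>(x, t). upper_mat r x t) xt $$ (i - 1, i - 1)) {1..r},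
          restrict (\<lambda>ij. (\<lambda>(x, t). upper_mat r x t) xt $$ ij) ?I) = xt"
        by (simp add: xt)
    qed
    show "(\<lambda>(x, t). upper_mat r x t) ` (?D \<times> ?T) \<subseteq> SL_upper r m"
    proof (rule image_subsetI)
      fix xt assume "xt \<in> ?D \<times> ?T"
      then obtain x t where xt: "xt = (x, t)" and x: "x \<in> ?D" and t: "t \<in> ?T" by auto
      have "upper_mat r x t $$ (i,j) \<in> zmod m" if "i < r" "j < r" for i j
      proof -
        have "x (Suc i) \<in> zmod m" using x that by (auto simp: PiE_iff)
        moreover have "t (i,j) \<in> zmod m" if "i < j"
          using t that \<open>j < r\<close> \<open>i < r\<close> by (auto simp: PiE_iff upper_pairs_def)
        moreover have "0 \<in> zmod m" using assms by (simp add: zmod_def)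
        ultimately show ?thesis using that by auto
      qed
      then have "upper_mat r x t \<in> SL r m"
        using x by (simp add: SL_eq mem_residue_mats det_upper_mat)
      then show "(\<lambda>(x, t). upper_mat r x t) xt \<in> SL_upper r m"
        by (auto simp: xt SL_upper_def upper_pairs_def)
    qed
    show "(\<lambda>X. (restrict (\<lambda>i. X $$ (i - 1, i - 1)) {1..r}, restrict (\<lambda>ij. X $$ ij) ?I)) `
        SL_upper r m \<subseteq> ?D \<times> ?T"
    proof (rule image_subsetI)
      fix X assume X: "X \<in> SL_upper r m"
      then have ent: "\<forall>i<r. \<forall>j<r. X $$ (i,j) \<in> zmod m" and "[det X = 1] (mod int m)"
        by (auto simp: SL_upper_def SL_eq mem_residue_mats)
      \<comment> \<open>By \<open>inv\<close>, \<open>X\<close> is the triangular matrix built from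
        its own entries, so its determinant is the product of its diagonal.\<close>
      then have "[(\<Prod>i=1..r. restrict (\<lambda>i. X $$ (i - 1, i - 1)) {1..r} i) = 1] (mod int m)"
        unfolding det_upper_mat[symmetric, where t = "restrict (\<lambda>ij. X $$ ij) ?I"] inv[OF X] by simp
      then show "(restrict (\<lambda>i. X $$ (i - 1, i - 1)) {1..r}, restrict (\<lambda>ij. X $$ ij) ?I) \<in> ?D \<times> ?T"
        using ent by (auto simp: upper_pairs_def)
    qed
  qed
  have "(\<Sum>X\<in>SL_upper r m. add_char m a (mat_trace X)) =
      (\<Sum>(x, t)\<in>?D \<times> ?T. add_char m a (\<Sum>i=1..r. x i))"
    unfolding sum.reindex_bij_betw[OF bij, symmetric]
    by (intro sum.cong refl) (auto simp: mat_trace_upper_mat)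
  also have "\<dots> = (\<Sum>x\<in>?D. of_nat (card ?T) * add_char m a (\<Sum>i=1..r. x i))"
    by (simp add: sum.cartesian_product[symmetric])
  also have "card ?T = m ^ (r * (r - 1) div 2)"
    by (simp add: card_PiE card_upper_pairs zmod_def)
  finally show ?thesis
    using assms by (simp add: hyper_kloosterman_def add_char_mod sum_distrib_left)
qed

theorem theorem5:
  fixes n r d :: nat and a :: int
  assumes "n \<ge> 1" and "r \<ge> 1"
    and "int d = gcd a (int n)"
  shows "SL_gauss_sum r n (add_char n a) =
    of_nat n ^ (r * (r - 1) div 2) * of_nat d ^ (r * (r + 1) div 2 - 1) *
    (\<Prod>p \<in> {p. prime p \<and> p dvd n \<and> \<not> p dvd n div d}. \<Prod>i=2..r. 1 - 1 / of_nat p ^ i) *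
    hyper_kloosterman r (n div d) (add_char (n div d) (a div int d))"
proof -
  define m where "m = n div d"
  have dvd: "d dvd n" "int d dvd a"
    using assms(3) by (metis gcd_dvd2 of_nat_dvd_iff, simp)
  then have n: "n = m * d" by (simp add: m_def)
  then have pos: "m \<ge> 1" "d \<ge> 1" using assms(1) by (auto simp: Suc_le_eq)
  \<comment> \<open>Dividing \<open>a\<close> and \<open>n\<close> by their gcd makes the induced
    character modulo \<open>m\<close> primitive.\<close>
  have "coprime (a div int d) (int n div int d)"
    unfolding assms(3) using assms(1) by (intro div_gcd_coprime) auto
  then have cop: "coprime (a div int d) (int m)" by (simp add: m_def zdiv_int)
  \<comment> \<open>The lift produces \<open>d\<close> to the power \<open>r\<^sup>2 - 1\<close>.
    The part \<open>r * (r - 1) div 2\<close> of this exponent combines with the same power of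
    \<open>m\<close> into a power of \<open>n\<close>, and the rest is the power of \<open>d\<close>
    in the claim.\<close>
  have "r * (r - 1) div 2 + (r * (r + 1) div 2 - 1) = r\<^sup>2 - 1"
  proof -
    have "r * (r + 1) = r * (r - 1) + r * 2"
      using assms(2) by (simp add: algebra_simps diff_mult_distrib2)
    then have "r * (r + 1) div 2 = r * (r - 1) div 2 + r" by simp
    moreover have "r * (r - 1) div 2 * 2 = r * (r - 1)" by (cases r) auto
    moreover have "r * (r - 1) + r = r\<^sup>2"
      using assms(2) by (simp add: power2_eq_square diff_mult_distrib2)
    ultimately show ?thesis using assms(2) by linarith
  qed
  then have pw: "(of_nat d :: complex) ^ (r\<^sup>2 - 1) =
      of_nat d ^ (r * (r - 1) div 2) * of_nat d ^ (r * (r + 1) div 2 - 1)"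
    by (metis power_add)
  have "add_char n a = (\<lambda>x. add_char m (a div int d) (x mod int m))"
    using add_char_reduce[OF assms(1) dvd] by (simp add: m_def)
  then have red: "SL_gauss_sum r n (add_char n a) = of_nat d ^ (r\<^sup>2 - 1) *
      (\<Prod>p \<in> {p. prime p \<and> p dvd n \<and> \<not> p dvd m}. \<Prod>i=2..r. 1 - 1 / of_nat p ^ i) *
      (of_nat m ^ (r * (r - 1) div 2) * hyper_kloosterman r m (add_char m (a div int d)))"
    unfolding SL_gauss_sum_eq_sum_upper[OF pos(1) cop, unfolded sum_SL_upper[OF pos(1)], symmetric]
    using SL_gauss_sum_lift[OF pos assms(2), of "add_char m (a div int d)", folded n] by simp
  have "(of_nat n :: complex) ^ (r * (r - 1) div 2) =
      of_nat m ^ (r * (r - 1) div 2) * of_nat d ^ (r * (r - 1) div 2)"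
    by (simp add: n power_mult_distrib)
  then show ?thesis
    unfolding m_def[symmetric] red pw by (simp only: mult_ac)
qed

end
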